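(* The naive product node optimization problem $\min_{\mathbf w\in\mathbb R^N}\hat\ell(\mathbf w)$ is non-convex. There exist parameter configurations where the Hessian matrix $\nabla^2_{\mathbf w}\hat\ell(\mathbf w)$ is not positive semi-definite.
   Context: The naive product node with weights $\mathbf w\in\mathbb R^N$ maps $\mathbf x\in\mathbb R^N$ to $f(\mathbf w;\mathbf x)=\prod_{i=1}^N(w_ix_i)$. Given inputs $\mathbf x_1,\dots,\mathbf x_M\in\mathbb R^N$, targets are generated by oracle weights $\mathbf w^{\mathrm{true}}$, $y_m^{\mathrm{true}}=f(\mathbf w^{\mathrm{true}};\mathbf x_m)$, and the empirical risk is $\hat\ell(\mathbf w)=\frac1M\sum_{m=1}^M\big(f(\mathbf w;\mathbf x_m)-y_m^{\mathrm{true}}\big)^2$. A parameter configuration is a choice of the weights $\mathbf w$ and oracle weights $\mathbf w^{\mathrm{true}}$.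
   Formalization: Assumes N ≥ 2 and that some input x_m has no zero coordinate; otherwise the claim is false (for N = 1 the risk is a convex quadratic, and if every input has a zero coordinate the risk is identically 0). *)

theory Defs
  imports "HOL-Analysis.Analysis"
begin

definition product_node :: "real ^ 'n \<Rightarrow> real ^ 'n \<Rightarrow> real" where
  "product_node w x = (\<Prod>i\<in>UNIV. w $ i * x $ i)"

text \<open>The inputs are \<open>x 1, \<dots>, x M\<close>; values of \<open>x\<close> at other indices are irrelevant.\<close>

definition oracle_target :: "(nat \<Rightarrow> real ^ 'n) \<Rightarrow> real ^ 'n \<Rightarrow> nat \<Rightarrow> real" where
  "oracle_target x w_true m = product_node w_true (x m)"

definition empirical_risk ::
    "nat \<Rightarrow> (nat \<Rightarrow> real ^ 'n) \<Rightarrow> real ^ 'n \<Rightarrow> real ^ 'n \<Rightarrow> real" where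
  "empirical_risk M x w_true w =
     1 / real M * (\<Sum>m=1..M. (product_node w (x m) - oracle_target x w_true m)\<^sup>2)"

definition partial_derivative :: "'n \<Rightarrow> (real ^ 'n \<Rightarrow> real) \<Rightarrow> real ^ 'n \<Rightarrow> real" where
  "partial_derivative i f w = deriv (\<lambda>t. f (w + t *\<^sub>R axis i 1)) 0"

text \<open>Since \<open>deriv\<close> is total, this is the Hessian only where the second partial
  derivatives exist; the empirical risk is a polynomial in the weights.\<close>

definition hessian :: "(real ^ 'n \<Rightarrow> real) \<Rightarrow> real ^ 'n \<Rightarrow> real ^ 'n ^ 'n" where
  "hessian f w = (\<chi> i j. partial_derivative i (partial_derivative j f) w)"

text \<open>Symmetry is deliberately not part of the definition, so that a matrix fails to be
  positive semi-definite only because its quadratic form takes a negative value.\<close>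

definition positive_semidefinite :: "real ^ 'n ^ 'n \<Rightarrow> bool" where
  "positive_semidefinite A \<longleftrightarrow> (\<forall>v. v \<bullet> (A *v v) \<ge> 0)"

end

theory Submission
  imports Defs
begin

text \<open>The risk is \<open>K (P w - a)\<^sup>2\<close> with \<open>P w\<close> the product of the weights, \<open>a = P w_true\<close> and
  \<open>K > 0\<close>. On a coordinate plane, with all other weights equal to 1, this is \<open>K (u v - a)\<^sup>2\<close>. For
  \<open>a \<noteq> 0\<close> it vanishes at \<open>(a, 1)\<close> and \<open>(-a, -1)\<close> but not at their midpoint, and for \<open>a = 0\<close> it
  vanishes at \<open>(2, 0)\<close> and \<open>(0, 2)\<close> but not at their midpoint. For \<open>a = 1\<close>, the Hessian at the
  origin of the plane has zero diagonal and off-diagonal entries \<open>-2 K\<close>, so it is negative in the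
  direction \<open>(1, 1)\<close>.\<close>

text \<open>The constant \<open>K\<close> above. As \<open>product_node w x\<close> splits into the
  product of the weights times the product of the inputs, the inputs enter the risk only through
  this factor.\<close>

definition mean_square_product :: "nat \<Rightarrow> (nat \<Rightarrow> real ^ 'n) \<Rightarrow> real" where
  "mean_square_product M x = 1 / real M * (\<Sum>m=1..M. (\<Prod>i\<in>UNIV. x m $ i)\<^sup>2)"

lemma empirical_risk_eq:
  "empirical_risk M x w_true w =
     mean_square_product M x * ((\<Prod>i\<in>UNIV. w $ i) - (\<Prod>i\<in>UNIV. w_true $ i))\<^sup>2"
  by (simp add: empirical_risk_def mean_square_product_def product_node_def oracle_target_def
      prod.distrib left_diff_distrib[symmetric] power_mult_distrib sum_distrib_left[symmetric])

lemma mean_square_product_pos: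
  fixes x :: "nat \<Rightarrow> real ^ 'n"
  assumes "m \<in> {1..M}" and "\<And>i. x m $ i \<noteq> 0"
  shows "mean_square_product M x > 0"
proof -
  have "(\<Sum>m=1..M. (\<Prod>i\<in>UNIV. x m $ i)\<^sup>2) > 0"
    by (rule sum_pos2[OF _ assms(1)]) (use assms(2) in auto)
  then show ?thesis
    using assms(1) by (auto simp: mean_square_product_def)
qed

text \<open>The value 1 at all other indices drops out of the product and survives averaging, so
  midpoints stay on the same coordinate plane.\<close>

definition two_weights :: "'n \<Rightarrow> 'n \<Rightarrow> real \<Rightarrow> real \<Rightarrow> real ^ 'n" where
  "two_weights i j u v = (\<chi> k. if k = i then u else if k = j then v else 1)"

lemma prod_two_weights:
  assumes "i \<noteq> j"
  shows "(\<Prod>k\<in>UNIV. two_weights i j u v $ k) = u * v"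
proof -
  have "(\<Prod>k\<in>UNIV. two_weights i j u v $ k) = (\<Prod>k\<in>{i, j}. two_weights i j u v $ k)"
    by (rule prod.mono_neutral_right) (auto simp: two_weights_def)
  then show ?thesis
    using assms by (simp add: two_weights_def)
qed

lemma empirical_risk_two_weights:
  assumes "i \<noteq> j"
  shows "empirical_risk M x w_true (two_weights i j u v) =
    mean_square_product M x * (u * v - (\<Prod>k\<in>UNIV. w_true $ k))\<^sup>2"
  by (simp add: empirical_risk_eq prod_two_weights[OF assms])

lemma midpoint_two_weights:
  "(1 / 2) *\<^sub>R two_weights i j u v + (1 / 2) *\<^sub>R two_weights i j u' v' =
     two_weights i j ((u + u') / 2) ((v + v') / 2)"
  by (simp add: vec_eq_iff two_weights_def)

lemma empirical_risk_not_convex: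
  fixes x :: "nat \<Rightarrow> real ^ 'n" and i j :: 'n
  assumes "i \<noteq> j" and pos: "mean_square_product M x > 0"
  shows "\<not> convex_on UNIV (empirical_risk M x w_true)"
proof
  assume convex: "convex_on UNIV (empirical_risk M x w_true)"
  define a where "a = (\<Prod>k\<in>UNIV. w_true $ k)"
  \<comment> \<open>Midpoint convexity on the plane, with the positive factor
    \<open>mean_square_product M x\<close> cancelled.\<close>
  have mid: "((u + u') / 2 * ((v + v') / 2) - a)\<^sup>2 \<le> ((u * v - a)\<^sup>2 + (u' * v' - a)\<^sup>2) / 2"
    for u v u' v'
  proof -
    let ?R = "empirical_risk M x w_true" and ?w = "two_weights i j u v"
      and ?w' = "two_weights i j u' v'"
    have "?R ((1 / 2) *\<^sub>R ?w + (1 / 2) *\<^sub>R ?w') \<le> (1 / 2) * ?R ?w + (1 / 2) * ?R ?w'"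
      using convex_onD[OF convex, of "1 / 2" ?w ?w'] by simp
    then have "mean_square_product M x * ((u + u') / 2 * ((v + v') / 2) - a)\<^sup>2
      \<le> mean_square_product M x * (((u * v - a)\<^sup>2 + (u' * v' - a)\<^sup>2) / 2)"
      unfolding midpoint_two_weights empirical_risk_two_weights[OF assms(1)] a_def
      by (simp only: distrib_left add_divide_distrib times_divide_eq_left times_divide_eq_right
          mult_1_left)
    then show ?thesis
      using pos by simp
  qed
  show False
  proof (cases "a = 0")
    case True
    then show False
      \<comment> \<open>\<open>of\<close> fills \<open>u\<close>, \<open>u'\<close>,
        \<open>v\<close>, \<open>v'\<close> in this order: the points are \<open>(2, 0)\<close> and
        \<open>(0, 2)\<close>, and the inequality becomes \<open>1 \<le> 0\<close>.\<close>
      using mid[of 2 0 0 2] by simp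
  next
    case False
    then show False
      using mid[of a "-a" 1 "-1"] by simp
  qed
qed

text \<open>The product is affine in each single weight. A general \<open>A\<close> is allowed
  because second derivatives also meet products with an index removed.\<close>

lemma prod_add_axis:
  fixes w :: "real ^ 'n"
  assumes "k \<in> A"
  shows "(\<Prod>l\<in>A. (w + t *\<^sub>R axis k 1) $ l) = (w $ k + t) * (\<Prod>l\<in>A - {k}. w $ l)"
proof -
  have "(\<Prod>l\<in>A. (w + t *\<^sub>R axis k 1) $ l) =
      (w + t *\<^sub>R axis k 1) $ k * (\<Prod>l\<in>A - {k}. (w + t *\<^sub>R axis k 1) $ l)"
    by (rule prod.remove) (use assms in auto)
  also have "(\<Prod>l\<in>A - {k}. (w + t *\<^sub>R axis k 1) $ l) = (\<Prod>l\<in>A - {k}. w $ l)"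
    by (rule prod.cong) (auto simp: axis_def)
  finally show ?thesis
    by (simp add: axis_def)
qed

lemma prod_add_axis_notin:
  fixes w :: "real ^ 'n"
  assumes "k \<notin> A"
  shows "(\<Prod>l\<in>A. (w + t *\<^sub>R axis k 1) $ l) = (\<Prod>l\<in>A. w $ l)"
  by (rule prod.cong) (use assms in \<open>auto simp: axis_def\<close>)

text \<open>Along axis \<open>k\<close> the risk is \<open>K ((w $ k + t) q - a)\<^sup>2\<close>,
  where \<open>q\<close>, the product of the other weights, does not depend on
  \<open>t\<close>.\<close>

lemma partial_derivative_empirical_risk:
  fixes x :: "nat \<Rightarrow> real ^ 'n"
  shows "partial_derivative k (empirical_risk M x w_true) w =
    2 * mean_square_product M x * ((\<Prod>l\<in>UNIV. w $ l) - (\<Prod>l\<in>UNIV. w_true $ l)) *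
      (\<Prod>l\<in>UNIV - {k}. w $ l)"
proof -
  have prod_k: "(\<Prod>l\<in>UNIV. w $ l) = w $ k * (\<Prod>l\<in>UNIV - {k}. w $ l)"
    by (rule prod.remove) auto
  have "((\<lambda>t. mean_square_product M x * ((w $ k + t) * q - a)\<^sup>2) has_real_derivative
      2 * mean_square_product M x * (w $ k * q - a) * q) (at 0)" for q a
    by (auto intro!: derivative_eq_intros)
  from DERIV_imp_deriv[OF this] show ?thesis
    by (simp only: partial_derivative_def empirical_risk_eq prod_add_axis[OF UNIV_I] prod_k)
qed

text \<open>The product over \<open>UNIV - {k}\<close> is constant along axis \<open>k\<close>, so
  the first partial derivative is affine there.\<close>

lemma hessian_empirical_risk_diagonal:
  fixes x :: "nat \<Rightarrow> real ^ 'n"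
  shows "hessian (empirical_risk M x w_true) w $ k $ k =
    2 * mean_square_product M x * (\<Prod>l\<in>UNIV - {k}. w $ l)\<^sup>2"
proof -
  have notin: "k \<notin> UNIV - {k}"
    by simp
  have "((\<lambda>t. 2 * mean_square_product M x * ((w $ k + t) * q - a) * q) has_real_derivative
      2 * mean_square_product M x * q\<^sup>2) (at 0)" for q a
    by (auto intro!: derivative_eq_intros simp: power2_eq_square)
  from DERIV_imp_deriv[OF this] show ?thesis
    \<comment> \<open>The instance of \<open>partial_derivative_def\<close> unfolds only the outer
      derivative; the inner one is replaced by its closed form.\<close>
    by (simp only: hessian_def partial_derivative_def[of k "partial_derivative _ _"]
        vec_lambda_beta partial_derivative_empirical_risk prod_add_axis[OF UNIV_I]
        prod_add_axis_notin[OF notin])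
qed

text \<open>Here both the residual and the product over \<open>UNIV - {j}\<close> contain weight
  \<open>i\<close>, so the product rule yields two terms.\<close>

lemma hessian_empirical_risk_off_diagonal:
  fixes x :: "nat \<Rightarrow> real ^ 'n"
  assumes "i \<noteq> j"
  shows "hessian (empirical_risk M x w_true) w $ i $ j =
    2 * mean_square_product M x *
      ((\<Prod>l\<in>UNIV - {i}. w $ l) * (\<Prod>l\<in>UNIV - {j}. w $ l) +
       ((\<Prod>l\<in>UNIV. w $ l) - (\<Prod>l\<in>UNIV. w_true $ l)) * (\<Prod>l\<in>UNIV - {i, j}. w $ l))"
proof -
  have i: "i \<in> UNIV - {j}" and eq: "UNIV - {j} - {i} = UNIV - {i, j}"
    using assms by auto
  have prod_i: "(\<Prod>l\<in>UNIV. w $ l) = w $ i * (\<Prod>l\<in>UNIV - {i}. w $ l)"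
    by (rule prod.remove) auto
  have prod_j: "(\<Prod>l\<in>UNIV - {j}. w $ l) = w $ i * (\<Prod>l\<in>UNIV - {i, j}. w $ l)"
    using prod.remove[OF _ i, of "($) w"] by (simp add: eq)
  have "((\<lambda>t. 2 * mean_square_product M x * ((w $ i + t) * q - a) * ((w $ i + t) * r))
      has_real_derivative
      2 * mean_square_product M x * (q * (w $ i * r) + (w $ i * q - a) * r)) (at 0)" for q r a
    by (auto intro!: derivative_eq_intros simp: algebra_simps)
  from DERIV_imp_deriv[OF this] show ?thesis
    by (simp only: hessian_def partial_derivative_def[of i "partial_derivative _ _"]
        vec_lambda_beta partial_derivative_empirical_risk prod_add_axis[OF UNIV_I]
        prod_add_axis[OF i] eq prod_i prod_j)
qed

lemma quadratic_form_axis_add: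
  fixes A :: "real ^ 'n ^ 'n"
  shows "(axis i 1 + axis j 1) \<bullet> (A *v (axis i 1 + axis j 1)) =
    A $ i $ i + A $ i $ j + A $ j $ i + A $ j $ j"
  by (simp add: matrix_vector_right_distrib inner_add_left inner_axis' matrix_vector_mult_basis
      column_def)

lemma hessian_empirical_risk_not_positive_semidefinite:
  fixes x :: "nat \<Rightarrow> real ^ 'n" and i j :: 'n
  assumes "i \<noteq> j" and "mean_square_product M x > 0"
  shows "\<not> positive_semidefinite (hessian (empirical_risk M x 1) (two_weights i j 0 0))"
proof -
  let ?w = "two_weights i j 0 0 :: real ^ 'n"
  let ?H = "hessian (empirical_risk M x 1) ?w"
  \<comment> \<open>Removing one of the two indices leaves the zero weight at the other.\<close>
  have zero: "(\<Prod>l\<in>UNIV - {i}. ?w $ l) = 0" "(\<Prod>l\<in>UNIV - {j}. ?w $ l) = 0"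
    using assms(1) by (auto simp: two_weights_def)
  have one: "(\<Prod>l\<in>UNIV - {i, j}. ?w $ l) = 1"
    by (rule prod.neutral) (auto simp: two_weights_def)
  have "?H $ i $ i = 0" "?H $ j $ j = 0"
    by (simp_all add: hessian_empirical_risk_diagonal zero)
  \<comment> \<open>Only the residual term survives, and the residual is \<open>0 - 1\<close>
    because all oracle weights are 1.\<close>
  moreover have "?H $ i $ j = - 2 * mean_square_product M x"
    by (simp only: hessian_empirical_risk_off_diagonal[OF assms(1)] zero one
        prod_two_weights[OF assms(1)]) simp
  moreover have "?H $ j $ i = - 2 * mean_square_product M x"
    by (simp only: hessian_empirical_risk_off_diagonal[OF assms(1)[symmetric]] zero one
        insert_commute[of j i] prod_two_weights[OF assms(1)]) simp
  ultimately have "(axis i 1 + axis j 1) \<bullet> (?H *v (axis i 1 + axis j 1)) < 0"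
    using assms(2) by (simp add: quadratic_form_axis_add)
  then show ?thesis
    unfolding positive_semidefinite_def not_all not_le by (rule exI)
qed

theorem propositionC3:
  fixes x :: "nat \<Rightarrow> real ^ 'n" and M :: nat
  assumes "CARD('n) \<ge> 2"
    and "\<exists>m\<in>{1..M}. \<forall>i. x m $ i \<noteq> 0"
  shows "(\<forall>w_true. \<not> convex_on UNIV (empirical_risk M x w_true)) \<and>
         (\<exists>w w_true. \<not> positive_semidefinite (hessian (empirical_risk M x w_true) w))"
proof -
  obtain S :: "'n set" where "card S = 2"
    using obtain_subset_with_card_n[OF assms(1)] by blast
  then obtain i j :: 'n where "i \<noteq> j"
    by (auto simp: card_2_iff)
  obtain m where "m \<in> {1..M}" and "\<And>i. x m $ i \<noteq> 0"
    using assms(2) by auto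
  then have "mean_square_product M x > 0"
    by (rule mean_square_product_pos)
  note empirical_risk_not_convex[OF \<open>i \<noteq> j\<close> this]
    hessian_empirical_risk_not_positive_semidefinite[OF \<open>i \<noteq> j\<close> this]
  then show ?thesis
    by (intro conjI allI exI)
qed

end
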